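(* Let $n$ and $r$ be positive integers with $2r \leq n$, and let $G$ be the vertex-disjoint union of $n$ paths each of length $2$ (i.e. each path has $3$ vertices and $2$ edges). Then $G$ is $r$-EKR: if $\mathcal{F}$ is an intersecting family of independent sets of $G$ each of size $r$, then $|\mathcal{F}| \leq \max_{v \in V(G)} |\{A \in \mathcal{I}^{(r)}_G : v \in A\}|$.
   Context: For a graph $G$, $\mathcal{I}^{(r)}_G$ denotes the family of all independent sets of $G$ of size exactly $r$. A family of sets is intersecting if any two of its members have nonempty intersection. For a vertex $v$, the family $\{A \in \mathcal{I}^{(r)}_G : v \in A\}$ is called an $r$-star (with centre $v$). A graph $G$ is called $r$-EKR if no intersecting subfamily of $\mathcal{I}^{(r)}_G$ has more members than the largest $r$-star of $G$. *)

theory Defs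
  imports "HOL-Library.Ramsey" "HOL-Library.Disjoint_Sets"
begin

text \<open>A graph is a pair of a vertex set and a set of edges, each edge being a two-element set
  of vertices.\<close>

type_synonym 'a graph = "'a set \<times> 'a set set"

abbreviation verts :: "'a graph \<Rightarrow> 'a set" where
  "verts G \<equiv> fst G"

abbreviation edges :: "'a graph \<Rightarrow> 'a set set" where
  "edges G \<equiv> snd G"

text \<open>The length of a path is its number of edges, so a path of length \<open>k\<close> has \<open>k + 1\<close> vertices.\<close>

definition path_graph :: "nat \<Rightarrow> 'a graph \<Rightarrow> bool" where
  "path_graph k P \<longleftrightarrow>
     (\<exists>xs. distinct xs \<and> length xs = k + 1 \<and> verts P = set xs \<and>
           edges P = {{xs ! i, xs ! (i + 1)} | i. i < k})"

definition graph_Union :: "'i set \<Rightarrow> ('i \<Rightarrow> 'a graph) \<Rightarrow> 'a graph" where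
  "graph_Union I P = (\<Union>i\<in>I. verts (P i), \<Union>i\<in>I. edges (P i))"

definition vertex_disjoint :: "'i set \<Rightarrow> ('i \<Rightarrow> 'a graph) \<Rightarrow> bool" where
  "vertex_disjoint I P \<longleftrightarrow> disjoint_family_on (\<lambda>i. verts (P i)) I"

definition independent_sets :: "nat \<Rightarrow> 'a graph \<Rightarrow> 'a set set" where
  "independent_sets r G = {A \<in> [verts G]\<^bsup>r\<^esup>. indep A (edges G)}"

definition intersecting :: "'a set set \<Rightarrow> bool" where
  "intersecting F \<longleftrightarrow> (\<forall>A\<in>F. \<forall>B\<in>F. A \<inter> B \<noteq> {})"

definition star :: "nat \<Rightarrow> 'a graph \<Rightarrow> 'a \<Rightarrow> 'a set set" where
  "star r G v = {A \<in> independent_sets r G. v \<in> A}"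

text \<open>Only meaningful when the vertex set is finite and nonempty, since otherwise \<open>Max\<close> and
  \<open>card\<close> may take arbitrary default values.\<close>

definition EKR :: "nat \<Rightarrow> 'a graph \<Rightarrow> bool" where
  "EKR r G \<longleftrightarrow>
     (\<forall>F. F \<subseteq> independent_sets r G \<and> intersecting F \<longrightarrow>
        card F \<le> Max ((\<lambda>v. card (star r G v)) ` verts G))"

end

theory Submission
  imports Defs "HOL-Combinatorics.Permutations"
begin

text \<open>Replacing, whenever possible, the centre of a path by one of its leaves does not destroy
  the intersecting property and ends in a family any two of whose members share a leaf. Such a
  family is split according to the numbers \<open>s\<close>, \<open>p\<close>, \<open>j\<close> of paths met in two leaves, in one
  leaf, in the centre. Each part lies in one orbit of the group generated by the permutations of the
  paths and the reflections of single paths, so Katona's averaging argument applies: the paths are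
  placed on a cycle, and of the \<open>2 * n\<close> arcs consisting of \<open>s\<close> consecutive paths met in both
  leaves, then \<open>p\<close> met in the first leaf and \<open>j\<close> met in the centre (and the mirror images of
  these arcs) every leaf lies in exactly \<open>2 * s + p \<le> r\<close>, while no more than \<open>2 * s + p\<close> pairwise
  share a leaf.\<close>

section \<open>Averaging over a transitive set of maps\<close>

text \<open>Composing with a map that takes \<open>x\<close> to \<open>y\<close> injects the pairs
  \<open>(g, j)\<close> hitting \<open>x\<close> into those hitting \<open>y\<close>. So all points
  of \<open>X\<close> are hit equally often, and summing the local bound over all \<open>g\<close>
  compares \<open>F\<close> with \<open>S\<close>. The sets \<open>B j\<close> are indexed because
  two arcs can coincide, for example when they consist of centres only.\<close>

lemma card_le_by_averaging:
  fixes \<Gamma> :: "('s \<Rightarrow> 's) set" and B :: "'j \<Rightarrow> 's"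
  assumes "finite \<Gamma>" and comp: "\<And>g h. g \<in> \<Gamma> \<Longrightarrow> h \<in> \<Gamma> \<Longrightarrow> g \<circ> h \<in> \<Gamma>"
    and inj: "\<And>g. g \<in> \<Gamma> \<Longrightarrow> inj g"
    and trans: "\<And>x y. x \<in> X \<Longrightarrow> y \<in> X \<Longrightarrow> \<exists>g\<in>\<Gamma>. g x = y"
    and "finite X" "finite J" "J \<noteq> {}" "B ` J \<subseteq> X" "F \<subseteq> X" "S \<subseteq> X"
    and le: "\<And>g. g \<in> \<Gamma> \<Longrightarrow> card {j \<in> J. g (B j) \<in> F} \<le> card {j \<in> J. g (B j) \<in> S}"
  shows "card F \<le> card S"
proof (cases "F = {}")
  case False
  then obtain x0 where x0: "x0 \<in> F" by blast
  define N where "N x = card {(g, j) \<in> \<Gamma> \<times> J. g (B j) = x}" for x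
  have fin: "finite {(g, j) \<in> \<Gamma> \<times> J. Q g j}" for Q
    by (rule finite_subset[of _ "\<Gamma> \<times> J"]) (use assms in auto)
  have N_le: "N x \<le> N y" if "x \<in> X" "y \<in> X" for x y
  proof -
    obtain h where h: "h \<in> \<Gamma>" "h x = y" using trans[OF \<open>x \<in> X\<close> \<open>y \<in> X\<close>] by blast
    have "inj_on (\<lambda>(g, j). (h \<circ> g, j)) {(g, j) \<in> \<Gamma> \<times> J. g (B j) = x}"
      using inj[OF h(1)] by (auto simp: inj_on_def fun_eq_iff)
    moreover have "(\<lambda>(g, j). (h \<circ> g, j)) ` {(g, j) \<in> \<Gamma> \<times> J. g (B j) = x}
        \<subseteq> {(g, j) \<in> \<Gamma> \<times> J. g (B j) = y}"
      using h comp by auto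
    ultimately show ?thesis unfolding N_def by (rule card_inj_on_le[OF _ _ fin])
  qed
  have N_eq: "N x = N x0" if "x \<in> X" for x
    using N_le that x0 \<open>F \<subseteq> X\<close> by (meson antisym subsetD)
  have count: "card T * N x0 = (\<Sum>g\<in>\<Gamma>. card {j \<in> J. g (B j) \<in> T})" if "T \<subseteq> X" for T
  proof -
    have "finite T" using that \<open>finite X\<close> finite_subset by blast
    have "card T * N x0 = (\<Sum>x\<in>T. N x)" using N_eq that by (simp add: subset_iff)
    also have "\<dots> = card (\<Union>x\<in>T. {(g, j) \<in> \<Gamma> \<times> J. g (B j) = x})"
      unfolding N_def by (subst card_UN_disjoint) (use fin \<open>finite T\<close> in auto)
    also have "(\<Union>x\<in>T. {(g, j) \<in> \<Gamma> \<times> J. g (B j) = x}) = (SIGMA g:\<Gamma>. {j \<in> J. g (B j) \<in> T})"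
      by auto
    also have "card \<dots> = (\<Sum>g\<in>\<Gamma>. card {j \<in> J. g (B j) \<in> T})"
      using assms by (subst card_SigmaI) auto
    finally show ?thesis .
  qed
  \<comment> \<open>Some map carries \<open>B j\<close> to \<open>x0\<close>, so the common
    multiplicity is positive and can be cancelled.\<close>
  obtain j where j: "j \<in> J" using \<open>J \<noteq> {}\<close> by blast
  then obtain g where "g \<in> \<Gamma>" "g (B j) = x0"
    using trans x0 assms by (metis image_subset_iff subsetD)
  then have "N x0 > 0"
    unfolding N_def using fin j by (auto simp: card_gt_0_iff)
  moreover have "card F * N x0 \<le> card S * N x0"
    using count[OF \<open>F \<subseteq> X\<close>] count[OF \<open>S \<subseteq> X\<close>] le by (simp add: sum_mono)
  ultimately show ?thesis by simp
qed simp

section \<open>Traces of independent sets on paths\<close>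

text \<open>An independent set meets the path with vertices \<open>0\<close>, \<open>1\<close>, \<open>2\<close> (in this order) in one of
  five ways.\<close>

datatype trace = Off | Mid | Lft | Rgt | Both

primrec pts :: "trace \<Rightarrow> nat set" where
  "pts Off = {}" | "pts Mid = {1}" | "pts Lft = {0}" | "pts Rgt = {2}" | "pts Both = {0, 2}"

text \<open>\<open>True\<close> names vertex 0 and \<open>False\<close> names vertex 2, so that a
  reflection acts on leaves as negation.\<close>

definition leaf :: "bool \<Rightarrow> trace \<Rightarrow> bool" where
  "leaf b t \<longleftrightarrow> t = Both \<or> t = (if b then Lft else Rgt)"

primrec flip :: "trace \<Rightarrow> trace" where
  "flip Off = Off" | "flip Mid = Mid" | "flip Lft = Rgt" | "flip Rgt = Lft" | "flip Both = Both"

text \<open>A canonical representative of each orbit of \<open>flip\<close>.\<close>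

definition kind :: "trace \<Rightarrow> trace" where
  "kind t = (if t = Rgt then Lft else t)"

lemma flip_flip [simp]: "flip (flip t) = t"
  by (cases t) auto

lemma leaf_flip [simp]: "leaf b (flip t) \<longleftrightarrow> leaf (\<not> b) t"
  by (cases t) (auto simp: leaf_def)

lemma kind_flip [simp]: "kind (flip t) = kind t"
  by (cases t) (auto simp: kind_def)

lemma kind_eq_iff: "kind s = kind t \<longleftrightarrow> s = t \<or> s = flip t"
  by (cases s; cases t) (auto simp: kind_def)

lemma card_pts_kind: "card (pts (kind t)) = card (pts t)"
  by (cases t) (auto simp: kind_def)

lemma finite_pts [simp]: "finite (pts t)"
  by (cases t) auto

lemma UNIV_trace: "UNIV = {Off, Mid, Lft, Rgt, Both}"
  using trace.exhaust by blast

instance trace :: finite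
  by standard (simp add: UNIV_trace)

text \<open>Fixing the value \<open>Off\<close> from \<open>n\<close> on leaves one function per
  choice of traces, which makes the set finite and the coding of independent sets injective.\<close>

definition cfg :: "nat \<Rightarrow> nat \<Rightarrow> (nat \<Rightarrow> trace) set" where
  "cfg n r = {f. (\<forall>i\<ge>n. f i = Off) \<and> (\<Sum>i<n. card (pts (f i))) = r}"

definition leaf_meet :: "nat \<Rightarrow> (nat \<Rightarrow> trace) \<Rightarrow> (nat \<Rightarrow> trace) \<Rightarrow> bool" where
  "leaf_meet n f g \<longleftrightarrow> (\<exists>i<n. \<exists>b. leaf b (f i) \<and> leaf b (g i))"

definition meet :: "nat \<Rightarrow> (nat \<Rightarrow> trace) \<Rightarrow> (nat \<Rightarrow> trace) \<Rightarrow> bool" where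
  "meet n f g \<longleftrightarrow> (\<exists>i<n. pts (f i) \<inter> pts (g i) \<noteq> {})"

lemma finite_cfg: "finite (cfg n r)"
proof (rule finite_subset)
  show "cfg n r \<subseteq> {f. \<forall>i. (i \<in> {..<n} \<longrightarrow> f i \<in> UNIV) \<and> (i \<notin> {..<n} \<longrightarrow> f i = Off)}"
    by (auto simp: cfg_def)
  show "finite \<dots>"
    by (rule finite_set_of_finite_funs) auto
qed

section \<open>Permutations of paths and reflections of single paths\<close>

definition act :: "(nat \<Rightarrow> nat) \<Rightarrow> nat set \<Rightarrow> (nat \<Rightarrow> trace) \<Rightarrow> nat \<Rightarrow> trace" where
  "act p E f = (\<lambda>i. if i \<in> E then flip (f (p i)) else f (p i))"

definition acts :: "nat \<Rightarrow> ((nat \<Rightarrow> trace) \<Rightarrow> nat \<Rightarrow> trace) set" where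
  "acts n = {act p E | p E. p permutes {..<n} \<and> E \<subseteq> {..<n}}"

lemma finite_acts: "finite (acts n)"
proof -
  have "acts n = (\<lambda>(p, E). act p E) ` ({p. p permutes {..<n}} \<times> Pow {..<n})"
    by (auto simp: acts_def)
  then show ?thesis by (simp add: finite_permutations)
qed

text \<open>Since \<open>act\<close> precomposes, the permutations compose in reverse order. Path
  \<open>i\<close> is reflected once for \<open>i \<in> E\<close> and once for
  \<open>p i \<in> D\<close>, and two reflections cancel.\<close>

lemma acts_comp:
  assumes "g \<in> acts n" "h \<in> acts n" shows "g \<circ> h \<in> acts n"
proof -
  obtain p E q D where g: "g = act p E" "p permutes {..<n}" "E \<subseteq> {..<n}"
    and h: "h = act q D" "q permutes {..<n}" "D \<subseteq> {..<n}"
    using assms by (auto simp: acts_def)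
  have "g \<circ> h = act (q \<circ> p) {i \<in> {..<n}. (i \<in> E) \<noteq> (p i \<in> D)}"
  proof (intro ext)
    fix f i
    have "p i = i" "i \<notin> E" "i \<notin> D" if "\<not> i < n"
      using that g h by (auto simp: permutes_def)
    then show "(g \<circ> h) f i = act (q \<circ> p) {i \<in> {..<n}. (i \<in> E) \<noteq> (p i \<in> D)} f i"
      by (cases "i < n") (auto simp: g h act_def)
  qed
  then show ?thesis
    using permutes_compose[OF g(2) h(2)] by (auto simp: acts_def)
qed

lemma acts_inj:
  assumes "g \<in> acts n" shows "inj g"
proof (rule injI)
  fix f f' assume eq: "g f = g f'"
  obtain p E where g: "g = act p E" "p permutes {..<n}"
    using assms by (auto simp: acts_def)
  show "f = f'"
  proof
    fix i
    obtain j where j: "i = p j" using permutes_surj[OF g(2)] by (metis surj_def)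
    show "f i = f' i"
      using fun_cong[OF eq, of j] flip_flip unfolding g j act_def by (metis (full_types))
  qed
qed

text \<open>A reflection exchanges the leaves of a path in both configurations at once, and a
  permutation only renumbers the paths.\<close>

lemma leaf_meet_act:
  assumes "g \<in> acts n"
  shows "leaf_meet n (g f) (g f') \<longleftrightarrow> leaf_meet n f f'"
proof -
  obtain p E where g: "g = act p E" "p permutes {..<n}"
    using assms by (auto simp: acts_def)
  have "leaf_meet n (g f) (g f') \<longleftrightarrow> (\<exists>i\<in>{..<n}. \<exists>b. leaf b (f (p i)) \<and> leaf b (f' (p i)))"
    unfolding leaf_meet_def g act_def by (auto simp: ex_bool_eq)
  also have "\<dots> \<longleftrightarrow> (\<exists>i\<in>p ` {..<n}. \<exists>b. leaf b (f i) \<and> leaf b (f' i))"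
    by auto
  finally show ?thesis
    unfolding permutes_image[OF g(2)] leaf_meet_def by auto
qed

text \<open>The orbit invariant: \<open>acts_kinds\<close> shows that the maps preserve it, and
  \<open>acts_transitive\<close> that it separates orbits among functions that are
  \<open>Off\<close> from \<open>n\<close> on.\<close>

definition kinds :: "nat \<Rightarrow> (nat \<Rightarrow> trace) \<Rightarrow> trace multiset" where
  "kinds n f = image_mset (\<lambda>i. kind (f i)) (mset_set {..<n})"

lemma count_kinds: "count (kinds n f) x = card {i \<in> {..<n}. kind (f i) = x}"
proof -
  have "count (kinds n f) x = (\<Sum>i\<in>{i \<in> {..<n}. kind (f i) = x}. count (mset_set {..<n}) i)"
    unfolding kinds_def count_image_mset by (rule sum.cong) auto
  also have "\<dots> = (\<Sum>i\<in>{i \<in> {..<n}. kind (f i) = x}. 1)"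
    by (rule sum.cong) auto
  finally show ?thesis by simp
qed

lemma size_kinds: "size (kinds n f) = n"
  by (simp add: kinds_def)

lemma sum_pts_kinds: "(\<Sum>i<n. card (pts (f i))) = (\<Sum>t\<in>#kinds n f. card (pts t))"
  unfolding kinds_def sum_unfold_sum_mset image_mset.compositionality comp_def card_pts_kind ..

lemma acts_transitive:
  assumes "kinds n f = kinds n f'" and "\<forall>i\<ge>n. f i = Off" and "\<forall>i\<ge>n. f' i = Off"
  shows "\<exists>g\<in>acts n. g f = f'"
proof -
  obtain p where p: "p permutes {..<n}" "\<And>i. i \<in> {..<n} \<Longrightarrow> kind (f' i) = kind (f (p i))"
    by (rule image_mset_eq_implies_permutes[of "{..<n}" "\<lambda>i. kind (f' i)" "\<lambda>i. kind (f i)"])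
      (use assms(1) in \<open>auto simp: kinds_def\<close>)
  \<comment> \<open>Traces of equal kind that differ are \<open>Lft\<close> and \<open>Rgt\<close>;
    exactly those paths are reflected.\<close>
  have "act p {i \<in> {..<n}. f' i \<noteq> f (p i)} f = f'"
  proof
    fix i
    have "p i = i" if "\<not> i < n" using p(1) that by (simp add: permutes_def)
    then show "act p {i \<in> {..<n}. f' i \<noteq> f (p i)} f i = f' i"
      using p(2)[of i] assms by (cases "i < n") (auto simp: act_def kind_eq_iff)
  qed
  then show ?thesis using p(1) unfolding acts_def by blast
qed

section \<open>Cyclic differences and Katona's pairing\<close>

text \<open>For \<open>i\<close> and \<open>t\<close> below \<open>n\<close> this is
  \<open>i - t\<close> modulo \<open>n\<close>; the case split keeps all later goals within linear
  arithmetic.\<close>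

definition offset :: "nat \<Rightarrow> nat \<Rightarrow> nat \<Rightarrow> nat" where
  "offset n i t = (if t \<le> i then i - t else i + n - t)"

lemma offset_less: "t < n \<Longrightarrow> i < n \<Longrightarrow> offset n i t < n"
  by (auto simp: offset_def)

text \<open>Rotation invariance: moving the origin to \<open>t\<close> keeps cyclic differences, so
  any member of a family can serve as origin.\<close>

lemma offset_offset:
  "t < n \<Longrightarrow> i < n \<Longrightarrow> j < n \<Longrightarrow> offset n (offset n i t) (offset n j t) = offset n i j"
  by (auto simp: offset_def)

lemma offset_inj: "t < n \<Longrightarrow> i < n \<Longrightarrow> j < n \<Longrightarrow> offset n i t = offset n j t \<Longrightarrow> i = j"
  by (auto simp: offset_def split: if_splits)

text \<open>Katona's pairing: with positions counted from a fixed member \<open>(b0, t0)\<close>, the positions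
  \<open>(b0, i)\<close>, \<open>(b0, i - l)\<close> and \<open>(\<not> b0, i - 1)\<close> exclude one another, so \<open>T\<close> contains at most one of
  them for each \<open>i < l\<close>.\<close>

lemma card_cyclic_le:
  fixes T :: "(bool \<times> nat) set"
  assumes "T \<subseteq> UNIV \<times> {..<n}" and "2 * l \<le> n"
    and same: "\<And>b t u. (b, t) \<in> T \<Longrightarrow> (b, u) \<in> T \<Longrightarrow> offset n t u < l \<or> offset n t u > n - l"
    and cross: "\<And>t u. (True, t) \<in> T \<Longrightarrow> (False, u) \<in> T \<Longrightarrow> offset n u t + 1 < l"
  shows "card T \<le> l"
proof (cases "T = {}")
  case False
  \<comment> \<open>The origin is taken with direction \<open>True\<close> if possible. Hence
    members of the other direction occur only if \<open>b0\<close> is \<open>True\<close>, and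
    \<open>cross\<close> then applies to them.\<close>
  obtain b0 t0 where t0: "(b0, t0) \<in> T" and b0: "b0 \<or> (\<forall>t. (True, t) \<notin> T)"
    using False by (metis (full_types) ex_in_conv surj_pair)
  \<comment> \<open>\<open>c\<close> computes the class \<open>i\<close> of a member in the pairing:
    \<open>d\<close> sends both \<open>i\<close> and \<open>i - l\<close> modulo \<open>n\<close> to
    \<open>i\<close>, and the opposite direction is shifted by one.\<close>
  define d where "d e = (if e < l then e else e + l - n)" for e
  define c where "c = (\<lambda>(b, t). if b = b0 then d (offset n t t0) else offset n t t0 + 1)"
  have lt: "t < n" if "(b, t) \<in> T" for b t using assms(1) that by auto
  have off: "offset n (offset n t t0) (offset n u t0) = offset n t u"
    if "(b, t) \<in> T" "(b', u) \<in> T" for b b' t u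
    using lt that t0 by (simp add: offset_offset)
  have mixed: "c (b0, t) \<noteq> c (b, u)" if "(b0, t) \<in> T" "(b, u) \<in> T" "b \<noteq> b0" for b t u
  proof -
    define e where "e = offset n t t0"
    define f where "f = offset n u t0"
    have "b0" "\<not> b" using b0 that by (metis (full_types))+
    then have "offset n f e + 1 < l" "f + 1 < l"
      using cross[of t u] cross[of t0 u] that t0 off unfolding e_def f_def by auto
    moreover have "e < l \<or> e > n - l" "e < n"
      using same[of b0 t t0] that t0 lt by (auto simp: e_def offset_less)
    \<comment> \<open>Equality would make the cyclic difference \<open>offset n f e\<close> equal to
      \<open>n - 1\<close> or \<open>l - 1\<close>, and \<open>cross\<close> excludes both.\<close>
    ultimately have "d e \<noteq> f + 1"
      using assms(2) unfolding d_def offset_def by (auto split: if_splits)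
    then show ?thesis using \<open>b \<noteq> b0\<close> by (simp add: c_def e_def f_def)
  qed
  have pure: "t = u" if "(b0, t) \<in> T" "(b0, u) \<in> T" "c (b0, t) = c (b0, u)" for t u
  proof -
    define e where "e = offset n t t0"
    define f where "f = offset n u t0"
    have "e < l \<or> e > n - l" "e < n" "f < l \<or> f > n - l" "f < n"
      using same[of b0 t t0] same[of b0 u t0] that t0 lt by (auto simp: e_def f_def offset_less)
    moreover have "offset n e f < l \<or> offset n e f > n - l"
      using same[of b0 t u] that off by (auto simp: e_def f_def)
    moreover have "d e = d f" using that(3) by (simp add: c_def e_def f_def)
    \<comment> \<open>Distinct residues with the same \<open>d\<close> have cyclic difference
      \<open>l\<close> or \<open>n - l\<close>; both violate \<open>same\<close> because
      \<open>2 * l \<le> n\<close>.\<close>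
    ultimately have "e = f"
      using assms(2) unfolding d_def offset_def by (auto split: if_splits)
    then show ?thesis using lt that t0 unfolding e_def f_def by (metis offset_inj)
  qed
  have "inj_on c T"
  proof (rule inj_onI, clarify)
    fix b t b' u assume tu: "(b, t) \<in> T" "(b', u) \<in> T" and eq: "c (b, t) = c (b', u)"
    show "b = b' \<and> t = u"
    proof (cases "b = b0 \<or> b' = b0")
      case True
      have "b' = b0" if "b = b0"
        by (rule ccontr) (use mixed[OF _ tu(2)] tu(1) eq that in blast)
      moreover have "b = b0" if "b' = b0"
        by (rule ccontr) (use mixed[OF _ tu(1)] tu(2) eq[symmetric] that in blast)
      ultimately have "b = b0 \<and> b' = b0" using True by blast
      then show ?thesis using pure[of t u] tu eq by auto
    next
      case False
      then have "offset n t t0 = offset n u t0" using eq by (simp add: c_def)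
      then show ?thesis using lt tu t0 False by (metis (full_types) offset_inj)
    qed
  qed
  moreover have "c ` T \<subseteq> {..<l}"
  proof clarify
    fix b t assume t: "(b, t) \<in> T"
    show "c (b, t) < l"
    proof (cases "b = b0")
      case True
      define e where "e = offset n t t0"
      have "e < l \<or> e > n - l" "e < n"
        using same[of b0 t t0] t True t0 lt by (auto simp: e_def offset_less)
      then have "d e < l" using assms(2) by (auto simp: d_def)
      then show ?thesis using True by (simp add: c_def e_def)
    next
      case False
      then have "b0" "\<not> b" using b0 t by (metis (full_types))+
      then show ?thesis
        using cross[of t0 t] t t0 by (auto simp: c_def)
    qed
  qed
  ultimately have "card T \<le> card {..<l}" by (rule card_inj_on_le) simp
  then show ?thesis by simp
qed simp

lemma acts_kinds:
  assumes "g \<in> acts n" shows "kinds n (g f) = kinds n f"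
proof -
  obtain p E where g: "g = act p E" "p permutes {..<n}"
    using assms by (auto simp: acts_def)
  have "kinds n (g f) = image_mset (\<lambda>i. kind (f (p i))) (mset_set {..<n})"
    unfolding kinds_def g act_def by (rule image_mset_cong) simp
  also have "\<dots> = image_mset (\<lambda>i. kind (f i)) (image_mset p (mset_set {..<n}))"
    by (simp add: image_mset.compositionality comp_def)
  finally show ?thesis
    by (simp add: kinds_def permutes_image_mset[OF g(2)] permutes_image[OF g(2)]
        image_mset_mset_set[OF permutes_inj_on[OF g(2)]])
qed

lemma acts_Off:
  assumes "g \<in> acts n" "\<forall>i\<ge>n. f i = Off" shows "\<forall>i\<ge>n. g f i = Off"
proof -
  obtain p E where g: "g = act p E" "p permutes {..<n}" "E \<subseteq> {..<n}"
    using assms(1) by (auto simp: acts_def)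
  have "p i = i" "i \<notin> E" if "n \<le> i" for i
    using that g(3) permutes_not_in[OF g(2), of i] by auto
  then show ?thesis using assms(2) by (simp add: g(1) act_def)
qed

lemma cfg_iff_kinds:
  "f \<in> cfg n r \<longleftrightarrow> (\<forall>i\<ge>n. f i = Off) \<and> (\<Sum>t\<in>#kinds n f. card (pts t)) = r"
  by (simp add: cfg_def sum_pts_kinds)

lemma bij_betw_offset:
  assumes "t < n"
  shows "bij_betw (\<lambda>i. offset n i t) {..<n} {..<n}"
    and "bij_betw (\<lambda>i. offset n t i) {..<n} {..<n}"
proof -
  show "bij_betw (\<lambda>i. offset n i t) {..<n} {..<n}"
    by (rule bij_betw_byWitness[where f' = "\<lambda>e. if e + t < n then e + t else e + t - n"])
      (use assms in \<open>auto simp: offset_def\<close>)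
  \<comment> \<open>A reflection of the cycle is its own inverse.\<close>
  show "bij_betw (\<lambda>i. offset n t i) {..<n} {..<n}"
    by (rule bij_betw_byWitness[where f' = "\<lambda>e. offset n t e"])
      (use assms in \<open>auto simp: offset_def\<close>)
qed

lemma card_bij_betw_less:
  assumes "bij_betw h {..<n} {..<n::nat}" "k \<le> n"
  shows "card {i \<in> {..<n}. h i < k} = k"
proof -
  have "bij_betw h {i \<in> {..<n}. h i < k} {e \<in> {..<n}. e < k}"
    using assms(1) by (rule bij_betw_Collect) auto
  moreover have "{e \<in> {..<n}. e < k} = {..<k}" using assms(2) by auto
  ultimately show ?thesis using bij_betw_same_card by fastforce
qed

section \<open>Arcs on the cycle of paths\<close>

text \<open>Reading \<open>\<tau>\<close> forwards from \<open>t\<close>, or backwards from \<open>t\<close> with the two leaves exchanged. The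
  exchange must be combined with the reversal: read forwards in both cases, too many arcs
  would pairwise share a leaf.\<close>

definition base :: "nat \<Rightarrow> (nat \<Rightarrow> trace) \<Rightarrow> bool \<times> nat \<Rightarrow> nat \<Rightarrow> trace" where
  "base n \<tau> = (\<lambda>(b, t) i. if i < n
     then if b then \<tau> (offset n i t) else flip (\<tau> (offset n t i)) else Off)"

lemma kinds_base:
  assumes "t < n" shows "kinds n (base n \<tau> (b, t)) = kinds n \<tau>"
proof -
  have *: "image_mset (\<lambda>i. kind (\<tau> (h i))) (mset_set {..<n}) = kinds n \<tau>"
    if "bij_betw h {..<n} {..<n}" for h
  proof -
    have "image_mset (\<lambda>i. kind (\<tau> (h i))) (mset_set {..<n})
        = image_mset (\<lambda>i. kind (\<tau> i)) (image_mset h (mset_set {..<n}))"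
      by (simp add: image_mset.compositionality comp_def)
    also have "image_mset h (mset_set {..<n}) = mset_set {..<n}"
      using that by (simp add: image_mset_mset_set bij_betw_def)
    finally show ?thesis by (simp add: kinds_def)
  qed
  have "kinds n (base n \<tau> (b, t))
      = image_mset (\<lambda>i. kind (\<tau> (if b then offset n i t else offset n t i))) (mset_set {..<n})"
    unfolding kinds_def base_def by (rule image_mset_cong) auto
  then show ?thesis
    using *[OF bij_betw_offset(1)[OF assms]] *[OF bij_betw_offset(2)[OF assms]] by (cases b) auto
qed

text \<open>The parameters are the ends of successive blocks, not their lengths. For
  \<open>s \<le> m\<close> the two leaves occupy initial segments of lengths \<open>m\<close> and
  \<open>s\<close>, so \<open>s + m\<close> is the total number of leaves met.\<close>

definition template :: "nat \<Rightarrow> nat \<Rightarrow> nat \<Rightarrow> nat \<Rightarrow> trace" where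
  "template s m k e = (if e < s then Both else if e < m then Lft else if e < k then Mid else Off)"

lemma leaf_template:
  "s \<le> m \<Longrightarrow> leaf b (template s m k e) \<longleftrightarrow> e < (if b then m else s)"
  by (auto simp: leaf_def template_def)

lemma template_exists:
  assumes "f \<in> cfg n r"
  obtains s m k where "s \<le> m" "s + m \<le> r" "kinds n (template s m k) = kinds n f"
proof -
  define s where "s = count (kinds n f) Both"
  define m where "m = s + count (kinds n f) Lft"
  define k where "k = m + count (kinds n f) Mid"
  have noR: "count (kinds n g) Rgt = 0" for g :: "nat \<Rightarrow> trace"
    unfolding count_kinds by (auto simp: kind_def)
  \<comment> \<open>As \<open>Rgt\<close> is never a kind, the counts of \<open>Both\<close>,
    \<open>Lft\<close> and \<open>Mid\<close> determine that of \<open>Off\<close> and hence the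
    multiset.\<close>
  have total: "count (kinds n g) Both + count (kinds n g) Lft + count (kinds n g) Mid
      + count (kinds n g) Off = n" for g :: "nat \<Rightarrow> trace"
  proof -
    have "size (kinds n g) = (\<Sum>t\<in>UNIV. count (kinds n g) t)"
      unfolding size_multiset_overloaded_eq
      by (rule sum.mono_neutral_left) (auto simp: not_in_iff)
    then show ?thesis using noR[of g] by (simp add: UNIV_trace size_kinds)
  qed
  have le: "s \<le> m" "m \<le> k" "k \<le> n" using total[of f] by (auto simp: s_def m_def k_def)
  have "count (kinds n (template s m k)) Both = card {..<s}"
    unfolding count_kinds using le
    by (intro arg_cong[where f = card]) (auto simp: template_def kind_def split: if_splits)
  moreover have "count (kinds n (template s m k)) Lft = card {s..<m}"
    unfolding count_kinds using le
    by (intro arg_cong[where f = card]) (auto simp: template_def kind_def split: if_splits)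
  moreover have "count (kinds n (template s m k)) Mid = card {m..<k}"
    unfolding count_kinds using le
    by (intro arg_cong[where f = card]) (auto simp: template_def kind_def split: if_splits)
  ultimately have c: "count (kinds n (template s m k)) t = count (kinds n f) t" for t
    using noR[of "template s m k"] noR[of f] total[of "template s m k"] total[of f]
    by (cases t) (auto simp: s_def m_def k_def)
  then have eq: "kinds n (template s m k) = kinds n f" by (rule multiset_eqI)
  \<comment> \<open>Each leaf met accounts for one of the \<open>r\<close> vertices.\<close>
  have "s + m = card {i \<in> {..<n}. i < s} + card {i \<in> {..<n}. i < m}"
    using le card_bij_betw_less[of "\<lambda>i. i" n s] card_bij_betw_less[of "\<lambda>i. i" n m]
    by (simp add: bij_betw_def)
  also have "\<dots> = (\<Sum>i<n. of_bool (i < s) + of_bool (i < m))"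
    by (simp add: sum.distrib Int_def)
  also have "\<dots> \<le> (\<Sum>i<n. card (pts (template s m k i)))"
    using le by (intro sum_mono) (auto simp: template_def)
  also have "\<dots> = r" using assms by (simp add: sum_pts_kinds eq cfg_iff_kinds)
  finally show ?thesis using that le eq by blast
qed

text \<open>A leaf fills a segment of length \<open>m\<close> or \<open>s\<close> in each arc. In
  arcs of equal direction the two segments have equal length, at most \<open>s + m\<close>. In
  opposite directions a common leaf at \<open>i\<close> lies less than \<open>m\<close> from one end
  and less than \<open>s\<close> from the other, whichever leaf it is, so the ends differ by at most
  \<open>s + m - 2\<close>.\<close>

lemma base_leaf_meet:
  assumes "leaf_meet n (base n (template s m k) (b, t)) (base n (template s m k) (b', u))"
    and "s \<le> m" "t < n" "u < n" "2 * (s + m) \<le> n"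
  shows "b = b' \<Longrightarrow> offset n t u < s + m \<or> offset n t u > n - (s + m)"
    and "b \<Longrightarrow> \<not> b' \<Longrightarrow> offset n u t + 1 < s + m"
proof -
  obtain i c where i: "i < n"
    and l: "leaf c (base n (template s m k) (b, t) i)" "leaf c (base n (template s m k) (b', u) i)"
    using assms(1) unfolding leaf_meet_def by blast
  show "b = b' \<Longrightarrow> offset n t u < s + m \<or> offset n t u > n - (s + m)"
    using i l assms
    by (auto simp: base_def leaf_template[OF assms(2)] offset_def split: if_splits)
  show "b \<Longrightarrow> \<not> b' \<Longrightarrow> offset n u t + 1 < s + m"
    using i l assms
    by (auto simp: base_def leaf_template[OF assms(2)] offset_def split: if_splits)
qed

text \<open>One direction contributes \<open>m\<close> arcs and the other \<open>s\<close>; the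
  exchange of leaves makes the total the same for both leaves.\<close>

lemma card_leaf_base:
  assumes "s \<le> m" "m \<le> n" "i < n"
  shows "card {j \<in> UNIV \<times> {..<n}. leaf b (base n (template s m k) j i)} = s + m"
proof -
  define A where "A = {t \<in> {..<n}. offset n i t < (if b then m else s)}"
  define D where "D = {t \<in> {..<n}. offset n t i < (if b then s else m)}"
  have le: "(if b then m else s) \<le> n" "(if b then s else m) \<le> n" using assms by auto
  have "card A = (if b then m else s)"
    unfolding A_def by (rule card_bij_betw_less[OF bij_betw_offset(2)[OF assms(3)] le(1)])
  moreover have "card D = (if b then s else m)"
    unfolding D_def by (rule card_bij_betw_less[OF bij_betw_offset(1)[OF assms(3)] le(2)])
  moreover have "card (Pair True ` A \<union> Pair False ` D) = card A + card D"
    by (subst card_Un_disjoint) (auto simp: A_def D_def card_image inj_on_def)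
  moreover have "{j \<in> UNIV \<times> {..<n}. leaf b (base n (template s m k) j i)}
      = Pair True ` A \<union> Pair False ` D"
    unfolding A_def D_def
    using assms by (auto simp: base_def leaf_template image_iff split: if_splits)
  ultimately show ?thesis by (simp split: if_splits)
qed

section \<open>Families whose members pairwise share a leaf\<close>

text \<open>Averaging over \<open>acts n\<close>: every image of the system of arcs has at most
  \<open>s + m\<close> indices in \<open>F\<close> by \<open>card_cyclic_le\<close>, and exactly
  \<open>s + m\<close> in the star by \<open>card_leaf_base\<close>.\<close>

lemma card_stratum_le:
  assumes "0 < n" "2 * r \<le> n" and F: "F \<subseteq> {f \<in> cfg n r. kinds n f = K}"
    and meet: "\<And>f g. f \<in> F \<Longrightarrow> g \<in> F \<Longrightarrow> leaf_meet n f g"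
  shows "card F \<le> card {f \<in> cfg n r. kinds n f = K \<and> leaf True (f 0)}"
proof (cases "F = {}")
  case False
  then obtain f0 where f0: "f0 \<in> cfg n r" "kinds n f0 = K" using F by blast
  obtain s m k where smk: "s \<le> m" "s + m \<le> r" "kinds n (template s m k) = K"
    using template_exists[OF f0(1)] f0(2) by metis
  define B where "B = base n (template s m k)"
  let ?X = "{f \<in> cfg n r. kinds n f = K}"
  let ?J = "UNIV \<times> {..<n}"
  have X: "g \<in> ?X" if "kinds n g = K" "\<forall>i\<ge>n. g i = Off" for g
    using that f0 by (simp add: cfg_iff_kinds)
  have BX: "B j \<in> ?X" if "j \<in> ?J" for j
  proof (rule X)
    show "kinds n (B j) = K" using that smk by (auto simp: B_def kinds_base)
    show "\<forall>i\<ge>n. B j i = Off" by (auto simp: B_def base_def split: prod.split)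
  qed
  show ?thesis
  proof (rule card_le_by_averaging[where \<Gamma> = "acts n" and X = ?X and J = ?J and B = B])
    show "\<exists>g\<in>acts n. g x = y" if "x \<in> ?X" "y \<in> ?X" for x y
      using that by (intro acts_transitive) (auto simp: cfg_def)
    show "finite ?X" using finite_cfg[of n r] by simp
    show "B ` ?J \<subseteq> ?X" using BX by blast
    show "?J \<noteq> {}" using \<open>0 < n\<close> by auto
    fix g assume g: "g \<in> acts n"
    obtain p E where gE: "g = act p E" "p permutes {..<n}" using g by (auto simp: acts_def)
    have "card {j \<in> ?J. g (B j) \<in> F} \<le> s + m"
    proof (rule card_cyclic_le)
      show n: "2 * (s + m) \<le> n" using smk assms by simp
      have lm: "leaf_meet n (B j) (B j')"
        if "j \<in> {j \<in> ?J. g (B j) \<in> F}" "j' \<in> {j \<in> ?J. g (B j) \<in> F}" for j j'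
        using that meet leaf_meet_act[OF g] by blast
      show "offset n t u < s + m \<or> n - (s + m) < offset n t u"
        if "(b, t) \<in> {j \<in> ?J. g (B j) \<in> F}" "(b, u) \<in> {j \<in> ?J. g (B j) \<in> F}" for b t u
        using base_leaf_meet(1)[OF lm[OF that, unfolded B_def]] that smk n by auto
      show "offset n u t + 1 < s + m"
        if "(True, t) \<in> {j \<in> ?J. g (B j) \<in> F}" "(False, u) \<in> {j \<in> ?J. g (B j) \<in> F}" for t u
        using base_leaf_meet(2)[OF lm[OF that, unfolded B_def]] that smk n by auto
    qed auto
    \<comment> \<open>Under \<open>g\<close>, leaf \<open>True\<close> of path 0 comes from path
      \<open>p 0\<close>, from its other leaf if \<open>0 \<in> E\<close>.\<close>
    also have "s + m = card {j \<in> ?J. leaf (0 \<notin> E) (B j (p 0))}"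
    proof -
      have "p 0 < n" using permutes_in_image[OF gE(2), of 0] \<open>0 < n\<close> by simp
      then show ?thesis
        using card_leaf_base smk assms unfolding B_def by simp
    qed
    also have "{j \<in> ?J. leaf (0 \<notin> E) (B j (p 0))}
        = {j \<in> ?J. g (B j) \<in> {f \<in> cfg n r. kinds n f = K \<and> leaf True (f 0)}}"
    proof -
      have "g (B j) \<in> ?X" if "j \<in> ?J" for j
        using BX[OF that] acts_Off[OF g] by (intro X) (auto simp: acts_kinds[OF g] cfg_def)
      moreover have "leaf True (g (B j) 0) \<longleftrightarrow> leaf (0 \<notin> E) (B j (p 0))" for j
        by (simp add: gE act_def)
      ultimately show ?thesis by blast
    qed
    finally show "card {j \<in> ?J. g (B j) \<in> F}
        \<le> card {j \<in> ?J. g (B j) \<in> {f \<in> cfg n r. kinds n f = K \<and> leaf True (f 0)}}" .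
  qed (use F acts_comp acts_inj finite_acts in auto)
qed simp

text \<open>The star and the family are compared orbit by orbit; the centre of the star is the same
  leaf in every orbit.\<close>

lemma card_leaf_meeting_le:
  assumes "0 < n" "2 * r \<le> n" and F: "F \<subseteq> cfg n r"
    and meet: "\<And>f g. f \<in> F \<Longrightarrow> g \<in> F \<Longrightarrow> leaf_meet n f g"
  shows "card F \<le> card {f \<in> cfg n r. leaf True (f 0)}"
proof -
  have split: "card T = (\<Sum>K\<in>kinds n ` cfg n r. card {f \<in> T. kinds n f = K})"
    if "T \<subseteq> cfg n r" for T
  proof -
    have "finite T" using that finite_cfg finite_subset by blast
    have "T = (\<Union>K\<in>kinds n ` cfg n r. {f \<in> T. kinds n f = K})" using that by auto
    also have "card \<dots> = (\<Sum>K\<in>kinds n ` cfg n r. card {f \<in> T. kinds n f = K})"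
      using \<open>finite T\<close> finite_cfg by (intro card_UN_disjoint) auto
    finally show ?thesis .
  qed
  have "card {f \<in> F. kinds n f = K} \<le> card {f \<in> {f \<in> cfg n r. leaf True (f 0)}. kinds n f = K}" for K
    using card_stratum_le[OF assms(1,2), of "{f \<in> F. kinds n f = K}" K] F meet
    by (simp add: subset_iff conj_commute conj_left_commute)
  then show ?thesis
    using split[OF F] split[of "{f \<in> cfg n r. leaf True (f 0)}"] by (simp add: sum_mono)
qed

section \<open>Compression from centres to leaves\<close>

lemma pts_meet_cases:
  assumes "pts a \<inter> pts b \<noteq> {}"
  obtains c where "leaf c a" "leaf c b" | "a = Mid" "b = Mid"
proof -
  have "(\<exists>c. leaf c a \<and> leaf c b) \<or> a = Mid \<and> b = Mid"
    using assms by (cases a; cases b) (auto simp: leaf_def ex_bool_eq)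
  then show ?thesis using that by blast
qed

lemma cfg_update_Lft:
  assumes "f \<in> cfg n r" "f i = Mid" shows "f(i := Lft) \<in> cfg n r"
proof -
  have "(\<Sum>j<n. card (pts ((f(i := Lft)) j))) = (\<Sum>j<n. card (pts (f j)))"
    using assms(2) by (intro sum.cong) auto
  moreover have "i < n" using assms by (force simp: cfg_def not_less[symmetric])
  ultimately show ?thesis using assms(1) by (auto simp: cfg_def)
qed

text \<open>The centre belongs to no trace but \<open>Mid\<close>, so the common vertex lies on a
  path other than \<open>i\<close> and survives the change.\<close>

lemma meet_update:
  assumes "meet n f g" "f i \<noteq> Mid" "g i = Mid" shows "meet n f (g(i := x))"
proof -
  obtain j where j: "j < n" "pts (f j) \<inter> pts (g j) \<noteq> {}"
    using assms(1) by (auto simp: meet_def)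
  have "j \<noteq> i" using j(2) assms(2,3) by (cases "f i") auto
  then show ?thesis using j by (auto simp: meet_def)
qed

text \<open>Among meeting families of the given size, one with the fewest centres in total is
  compressed: otherwise shifting at \<open>i\<close> all members that can move would reduce that
  number.\<close>

lemma obtain_compressed:
  assumes F: "F \<subseteq> cfg n r" and meet: "\<And>f g. f \<in> F \<Longrightarrow> g \<in> F \<Longrightarrow> meet n f g"
  obtains H where "H \<subseteq> cfg n r" "card H = card F" "\<And>f g. f \<in> H \<Longrightarrow> g \<in> H \<Longrightarrow> meet n f g"
    "\<And>f i. f \<in> H \<Longrightarrow> f i = Mid \<Longrightarrow> f(i := Lft) \<in> H"
proof -
  define P where "P H \<longleftrightarrow> H \<subseteq> cfg n r \<and> card H = card F \<and> (\<forall>f\<in>H. \<forall>g\<in>H. meet n f g)" for H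
  define \<mu> where "\<mu> H = (\<Sum>f\<in>H. card {i \<in> {..<n}. f i = Mid})" for H
  have "P F" using assms by (auto simp: P_def)
  then obtain H where "P H" and min: "\<And>H'. P H' \<Longrightarrow> \<mu> H \<le> \<mu> H'"
    using ex_has_least_nat[of P F \<mu>] by blast
  then have H: "H \<subseteq> cfg n r" "card H = card F" "\<And>f g. f \<in> H \<Longrightarrow> g \<in> H \<Longrightarrow> meet n f g"
    by (auto simp: P_def)
  have fin: "finite H" using H(1) finite_cfg finite_subset by blast
  have "f(i := Lft) \<in> H" if f: "f \<in> H" "f i = Mid" for f i
  proof (rule ccontr)
    assume nf: "f(i := Lft) \<notin> H"
    have i: "i < n" using f H(1) by (force simp: cfg_def not_less[symmetric])
    \<comment> \<open>Only members whose shifted copy is missing move, so the size is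
      preserved.\<close>
    define U where "U = {f \<in> H. f i = Mid \<and> f(i := Lft) \<notin> H}"
    define V where "V = (\<lambda>f. f(i := Lft)) ` U"
    have U: "U \<subseteq> H" "f \<in> U" using f nf by (auto simp: U_def)
    have finU: "finite U" using U(1) fin finite_subset by blast
    have inj: "inj_on (\<lambda>f. f(i := Lft)) U"
    proof (rule inj_onI)
      fix g h assume "g \<in> U" "h \<in> U" and eq: "g(i := Lft) = h(i := Lft)"
      then have "g i = h i" by (simp add: U_def)
      then show "g = h" using eq by (metis fun_upd_triv fun_upd_upd)
    qed
    have disj: "(H - U) \<inter> V = {}" by (auto simp: U_def V_def)
    \<comment> \<open>If \<open>g\<close> has centre \<open>i\<close> but stays, its shifted copy is
      already in \<open>H\<close> and meets \<open>h\<close> away from \<open>i\<close>; there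
      \<open>g\<close> meets the shifted \<open>h\<close> as well.\<close>
    have one: "meet n g (h(i := Lft))" if g: "g \<in> H - U" and h: "h \<in> U" for g h
    proof (cases "g i = Mid")
      case True
      then have "g(i := Lft) \<in> H" using g by (auto simp: U_def)
      then have "meet n (g(i := Lft)) h" using H(3) h U(1) by blast
      then show ?thesis
        using h by (auto simp: meet_def U_def split: if_splits)
    next
      case False
      then show ?thesis
        using meet_update[of n g h i Lft] H(3)[of g h] g h U(1) by (auto simp: U_def)
    qed
    have sym: "meet n g h \<longleftrightarrow> meet n h g" for g h by (auto simp: meet_def)
    \<comment> \<open>Two shifted members share vertex 0 of path \<open>i\<close>.\<close>
    have two: "meet n (g(i := Lft)) (h(i := Lft))" for g h
      using i by (auto simp: meet_def intro!: exI[of _ i])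
    have "P (H - U \<union> V)" unfolding P_def
    proof (intro conjI ballI)
      show "H - U \<union> V \<subseteq> cfg n r"
        using H(1) cfg_update_Lft U(1) by (auto simp: V_def U_def)
      have "card (H - U \<union> V) = card (H - U) + card V"
        using disj fin finU by (intro card_Un_disjoint) (auto simp: V_def)
      also have "card V = card U" unfolding V_def by (rule card_image[OF inj])
      also have "card (H - U) + card U = card H"
        using U(1) fin finU by (simp add: card_Diff_subset card_mono)
      finally show "card (H - U \<union> V) = card F" using H(2) by simp
      show "meet n g h" if gh: "g \<in> H - U \<union> V" "h \<in> H - U \<union> V" for g h
      proof -
        consider "g \<in> H - U" "h \<in> H - U" | "g \<in> H - U" "h \<in> V" | "g \<in> V" "h \<in> H - U"
          | "g \<in> V" "h \<in> V" using gh by blast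
        then show ?thesis
        proof cases
          case 1 then show ?thesis using H(3) by blast
        next
          case 2 then show ?thesis using one unfolding V_def by blast
        next
          case 3 then show ?thesis using one sym unfolding V_def by blast
        next
          case 4 then show ?thesis using two unfolding V_def by blast
        qed
      qed
    qed
    moreover have "\<mu> (H - U \<union> V) < \<mu> H"
    proof -
      have "\<mu> (H - U \<union> V) = \<mu> (H - U) + \<mu> V"
        unfolding \<mu>_def using disj fin finU by (intro sum.union_disjoint) (auto simp: V_def)
      also have "\<mu> V = (\<Sum>f\<in>U. card {j \<in> {..<n}. (f(i := Lft)) j = Mid})"
        unfolding \<mu>_def V_def by (simp add: sum.reindex[OF inj])
      also have "\<dots> < \<mu> U" unfolding \<mu>_def
      proof (rule sum_strict_mono)
        fix g assume "g \<in> U"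
        then show "card {j \<in> {..<n}. (g(i := Lft)) j = Mid} < card {j \<in> {..<n}. g j = Mid}"
          using i by (intro psubset_card_mono psubsetI) (auto simp: U_def set_eq_iff split: if_splits)
      qed (use finU U in auto)
      also have "\<mu> (H - U) + \<mu> U = \<mu> H"
        unfolding \<mu>_def by (rule sum.subset_diff[OF U(1) fin, symmetric])
      finally show ?thesis by simp
    qed
    ultimately show False using min by force
  qed
  then show ?thesis using that H by blast
qed

lemma card_meeting_le:
  assumes "0 < n" "2 * r \<le> n" and "F \<subseteq> cfg n r"
    and "\<And>f g. f \<in> F \<Longrightarrow> g \<in> F \<Longrightarrow> meet n f g"
  shows "card F \<le> card {f \<in> cfg n r. leaf True (f 0)}"
proof -
  obtain H where H: "H \<subseteq> cfg n r" "card H = card F" "\<And>f g. f \<in> H \<Longrightarrow> g \<in> H \<Longrightarrow> meet n f g"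
    "\<And>f i. f \<in> H \<Longrightarrow> f i = Mid \<Longrightarrow> f(i := Lft) \<in> H"
    using obtain_compressed[of F n r] assms(3,4) by metis
  \<comment> \<open>If \<open>f\<close> and \<open>g\<close> share the centre of path
    \<open>k\<close>, the compressed family also contains \<open>f(k := Lft)\<close>, which has
    fewer centres. The leaf it shares with \<open>g\<close> is not on path \<open>k\<close>, where
    \<open>g\<close> has only the centre, so \<open>f\<close> shares it too.\<close>
  have "leaf_meet n f g" if "f \<in> H" and g: "g \<in> H" for f g
    using that(1)
  proof (induction "card {i \<in> {..<n}. f i = Mid}" arbitrary: f rule: less_induct)
    case less
    obtain k where k: "k < n" "pts (f k) \<inter> pts (g k) \<noteq> {}"
      using H(3)[OF less.prems g] by (auto simp: meet_def)
    from k(2) show ?case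
    proof (cases rule: pts_meet_cases)
      case (1 c)
      then show ?thesis using k by (auto simp: leaf_meet_def)
    next
      case 2
      have "card {i \<in> {..<n}. (f(k := Lft)) i = Mid} < card {i \<in> {..<n}. f i = Mid}"
        using k(1) 2 by (intro psubset_card_mono psubsetI) (auto simp: set_eq_iff split: if_splits)
      then have "leaf_meet n (f(k := Lft)) g"
        using less.hyps H(4)[OF less.prems] 2 by blast
      then obtain j c where "j < n" "leaf c ((f(k := Lft)) j)" "leaf c (g j)"
        by (auto simp: leaf_meet_def)
      moreover have "j \<noteq> k" using calculation 2 by (auto simp: leaf_def split: if_splits)
      ultimately show ?thesis by (auto simp: leaf_meet_def)
    qed
  qed
  then show ?thesis using card_leaf_meeting_le[OF assms(1,2) H(1)] H(2) by simp
qed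

section \<open>Coding independent sets by traces\<close>

lemma path_graph_2E:
  assumes "path_graph 2 Q"
  obtains w where "inj_on w {0, 1, 2 :: nat}" "verts Q = w ` {0, 1, 2}"
    "edges Q = {{w 0, w 1}, {w 1, w 2}}"
proof -
  obtain xs where xs: "distinct xs" "length xs = 3" "verts Q = set xs"
    "edges Q = {{xs ! i, xs ! (i + 1)} | i. i < 2}"
    using assms by (auto simp: path_graph_def)
  have "{0, 1, 2} = {..<3 :: nat}" by auto
  moreover have "set xs = (!) xs ` {..<3}"
    using xs(2) by (auto simp: set_conv_nth)
  moreover have "inj_on ((!) xs) {..<3}"
    using xs(1,2) by (auto simp: inj_on_def nth_eq_iff_index_eq)
  moreover have "edges Q = {{xs ! 0, xs ! 1}, {xs ! 1, xs ! 2}}"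
  proof -
    have "{f i | i. i < (2 :: nat)} = {f 0, f 1}" for f :: "nat \<Rightarrow> 'a set"
      by (auto simp: less_2_cases_iff)
    then show ?thesis unfolding xs(4) by (simp add: numeral_2_eq_2)
  qed
  ultimately show ?thesis using that[of "(!) xs"] xs(3) by simp
qed

lemma pts_subset: "k \<in> pts t \<Longrightarrow> k \<in> {0, 1, 2}"
  by (cases t) auto

lemma pts_inject: "pts s = pts t \<longleftrightarrow> s = t"
  by (cases s; cases t) auto

text \<open>The five traces are exactly the independent subsets of one path and no edge joins two
  paths, so an independent set amounts to a free choice of a trace on each path.\<close>

lemma bij_betw_independent_sets:
  fixes v :: "nat \<Rightarrow> nat \<Rightarrow> 'a"
  assumes inj: "\<And>i j k l. i < n \<Longrightarrow> j < n \<Longrightarrow> k \<in> {0, 1, 2} \<Longrightarrow> l \<in> {0, 1, 2} \<Longrightarrow>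
      v i k = v j l \<Longrightarrow> i = j \<and> k = l"
    and V: "verts G = (\<Union>i<n. v i ` {0, 1, 2})"
    and E: "edges G = (\<Union>i<n. {{v i 0, v i 1}, {v i 1, v i 2}})"
  shows "bij_betw (\<lambda>f. \<Union>i<n. v i ` pts (f i)) (cfg n r) (independent_sets r G)"
proof -
  define \<Phi> where "\<Phi> f = (\<Union>i<n. v i ` pts (f i))" for f
  have mem: "v i k \<in> \<Phi> f \<longleftrightarrow> k \<in> pts (f i)" if "i < n" "k \<in> {0, 1, 2}" for f i k
  proof
    assume "v i k \<in> \<Phi> f"
    then obtain j l where "j < n" "l \<in> pts (f j)" "v i k = v j l"
      unfolding \<Phi>_def by auto
    then show "k \<in> pts (f i)"
      using inj[OF that(1) _ that(2) pts_subset] by metis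
  next
    assume "k \<in> pts (f i)"
    then show "v i k \<in> \<Phi> f" using that unfolding \<Phi>_def by auto
  qed
  have card: "card (\<Phi> f) = (\<Sum>i<n. card (pts (f i)))" for f
  proof -
    have "card (\<Phi> f) = (\<Sum>i<n. card (v i ` pts (f i)))"
      unfolding \<Phi>_def
    proof (intro card_UN_disjoint ballI impI)
      fix i j assume ij: "i \<in> {..<n}" "j \<in> {..<n}" "i \<noteq> j"
      have "v i k \<noteq> v j l" if "k \<in> pts (f i)" "l \<in> pts (f j)" for k l
        using inj[OF _ _ pts_subset[OF that(1)] pts_subset[OF that(2)]] ij by auto
      then show "v i ` pts (f i) \<inter> v j ` pts (f j) = {}" by auto
    qed auto
    also have "\<dots> = (\<Sum>i<n. card (pts (f i)))"
    proof (intro sum.cong card_image inj_onI)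
      fix i k l assume "i \<in> {..<n}" and k: "k \<in> pts (f i)" and l: "l \<in> pts (f i)" and "v i k = v i l"
      then show "k = l" using inj[OF _ _ pts_subset[OF k] pts_subset[OF l]] by auto
    qed auto
    finally show ?thesis .
  qed
  have sub: "\<Phi> f \<subseteq> verts G" for f
    unfolding \<Phi>_def V by (intro UN_mono image_mono subsetI pts_subset) auto
  have "inj_on \<Phi> (cfg n r)"
  proof (intro inj_onI ext)
    fix f g i assume fg: "f \<in> cfg n r" "g \<in> cfg n r" "\<Phi> f = \<Phi> g"
    show "f i = g i"
    proof (cases "i < n")
      case True
      then have "k \<in> pts (f i) \<longleftrightarrow> k \<in> pts (g i)" if "k \<in> {0, 1, 2}" for k
        using mem that fg(3) by metis
      then have "pts (f i) = pts (g i)" using pts_subset by (intro set_eqI iffI) metis+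
      then show ?thesis by (simp add: pts_inject)
    next
      case False
      then show ?thesis using fg by (simp add: cfg_def)
    qed
  qed
  moreover have "\<Phi> f \<in> independent_sets r G" if f: "f \<in> cfg n r" for f
  proof -
    have fin: "finite (\<Phi> f)" unfolding \<Phi>_def by auto
    have nodd: "\<not> (1 \<in> pts t \<and> (0 \<in> pts t \<or> 2 \<in> pts t))" for t by (cases t) auto
    have no_edge: False if ab: "a \<in> \<Phi> f" "b \<in> \<Phi> f" and e: "{a, b} \<in> edges G" for a b
    proof -
      obtain i where i: "i < n" "{a, b} = {v i 0, v i 1} \<or> {a, b} = {v i 1, v i 2}"
        using e unfolding E by blast
      then have "v i 1 \<in> \<Phi> f \<and> (v i 0 \<in> \<Phi> f \<or> v i 2 \<in> \<Phi> f)"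
        using ab by (auto simp: doubleton_eq_iff)
      then show False using mem[OF i(1)] nodd[of "f i"] by blast
    qed
    then have "indep (\<Phi> f) (edges G)" unfolding indep_def by blast
    then show ?thesis
      using card[of f] f fin sub[of f] by (simp add: independent_sets_def nsets_def cfg_def)
  qed
  moreover have "\<exists>f\<in>cfg n r. \<Phi> f = A" if A: "A \<in> independent_sets r G" for A
  proof -
    \<comment> \<open>Testing the centre first loses nothing: by \<open>no\<close> below, a set
      containing it avoids both leaves of that path.\<close>
    define f where "f i = (if \<not> i < n then Off else if v i 1 \<in> A then Mid
        else if v i 0 \<in> A then (if v i 2 \<in> A then Both else Lft)
        else if v i 2 \<in> A then Rgt else Off)" for i
    have AV: "A \<subseteq> verts G" "card A = r" and ind: "indep A (edges G)"
      using A by (auto simp: independent_sets_def nsets_def)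
    have no: "v i 0 \<notin> A \<and> v i 2 \<notin> A" if "i < n" "v i 1 \<in> A" for i
    proof -
      \<comment> \<open>\<open>indep\<close> constrains only pairs of distinct vertices.\<close>
      have "v i 0 \<noteq> v i 1" "v i 1 \<noteq> v i 2"
        using inj[of i i 0 1] inj[of i i 1 2] that by auto
      moreover have "{v i 0, v i 1} \<in> edges G" "{v i 1, v i 2} \<in> edges G"
        using that unfolding E by auto
      ultimately show ?thesis using ind that(2) unfolding indep_def by metis
    qed
    have f: "k \<in> pts (f i) \<longleftrightarrow> v i k \<in> A" if "i < n" "k \<in> {0, 1, 2}" for i k
      using that no[of i] by (auto simp: f_def)
    have "\<Phi> f = A"
    proof (intro set_eqI iffI)
      fix x assume "x \<in> \<Phi> f"
      then obtain i k where "i < n" "k \<in> pts (f i)" "x = v i k" unfolding \<Phi>_def by auto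
      then show "x \<in> A" using f pts_subset by metis
    next
      fix x assume x: "x \<in> A"
      then obtain i k where "i < n" "k \<in> {0, 1, 2}" "x = v i k" using AV(1) unfolding V by blast
      then show "x \<in> \<Phi> f" using x f mem by simp
    qed
    moreover have "f \<in> cfg n r"
      using card[of f] AV(2) \<open>\<Phi> f = A\<close> by (auto simp: cfg_def f_def)
    ultimately show ?thesis by blast
  qed
  ultimately have "bij_betw \<Phi> (cfg n r) (independent_sets r G)"
    by (auto simp: bij_betw_def)
  then show ?thesis by (simp add: \<Phi>_def[abs_def])
qed

theorem theorem1:
  fixes n r :: nat and P :: "nat \<Rightarrow> 'a graph" and G :: "'a graph"
  assumes "n \<ge> 1" and "r \<ge> 1" and "2 * r \<le> n"
    and "\<And>i. i < n \<Longrightarrow> path_graph 2 (P i)"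
    and "vertex_disjoint {..<n} P"
    and "G = graph_Union {..<n} P"
  shows "EKR r G"
proof -
  have "\<forall>i\<in>{..<n}. \<exists>w. inj_on w {0, 1, 2 :: nat} \<and> verts (P i) = w ` {0, 1, 2} \<and>
      edges (P i) = {{w 0, w 1}, {w 1, w 2}}"
    using assms(4) by (metis lessThan_iff path_graph_2E)
  then obtain v where v: "\<And>i. i < n \<Longrightarrow> inj_on (v i) {0, 1, 2 :: nat}"
    "\<And>i. i < n \<Longrightarrow> verts (P i) = v i ` {0, 1, 2}"
    "\<And>i. i < n \<Longrightarrow> edges (P i) = {{v i 0, v i 1}, {v i 1, v i 2}}"
    by (metis bchoice lessThan_iff)
  have inj: "i = j \<and> k = l"
    if "i < n" "j < n" "k \<in> {0, 1, 2}" "l \<in> {0, 1, 2}" "v i k = v j l" for i j k l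
  proof -
    have "v i k \<in> verts (P i) \<inter> verts (P j)" using that v(2) by auto
    then have "i = j"
      using assms(5) that(1,2) by (auto simp: vertex_disjoint_def disjoint_family_on_def)
    then show ?thesis
      using inj_onD[OF v(1)[OF that(1)] _ that(3,4)] that(5) by simp
  qed
  have V: "verts G = (\<Union>i<n. v i ` {0, 1, 2})"
    using v(2) by (auto simp: assms(6) graph_Union_def)
  have E: "edges G = (\<Union>i<n. {{v i 0, v i 1}, {v i 1, v i 2}})"
    using v(3) by (auto simp: assms(6) graph_Union_def)
  define \<Phi> where "\<Phi> f = (\<Union>i<n. v i ` pts (f i))" for f
  have bij: "bij_betw \<Phi> (cfg n r) (independent_sets r G)"
    unfolding \<Phi>_def[abs_def] by (rule bij_betw_independent_sets[OF _ V E], rule inj)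
  show ?thesis
    unfolding EKR_def
  proof (intro allI impI, elim conjE)
    fix F assume F: "F \<subseteq> independent_sets r G" "intersecting F"
    \<comment> \<open>The family is pulled back to configurations; by \<open>inj\<close> a common
      vertex of two images lies on the same path at the same position.\<close>
    define H where "H = {f \<in> cfg n r. \<Phi> f \<in> F}"
    have "meet n f g" if "f \<in> H" "g \<in> H" for f g
    proof -
      have "\<Phi> f \<inter> \<Phi> g \<noteq> {}"
        using that F(2) by (simp add: H_def intersecting_def)
      then obtain i j k l where "i < n" "j < n" and k: "k \<in> pts (f i)" and l: "l \<in> pts (g j)"
        and "v i k = v j l"
        unfolding \<Phi>_def by auto
      then show ?thesis
        using inj[OF _ _ pts_subset[OF k] pts_subset[OF l]] k l by (auto simp: meet_def)
    qed
    moreover have fin: "finite (independent_sets r G)"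
      using bij_betw_finite[OF bij] finite_cfg by simp
    ultimately have "card H \<le> card {f \<in> cfg n r. leaf True (f 0)}"
      using assms(1,3) by (intro card_meeting_le) (auto simp: H_def)
    also have "card H = card F"
    proof -
      have "F \<subseteq> \<Phi> ` cfg n r" using bij F(1) by (simp add: bij_betw_def)
      then have "\<Phi> ` H = F" unfolding H_def by blast
      moreover have "inj_on \<Phi> H"
        by (rule inj_on_subset[OF bij_betw_imp_inj_on[OF bij]]) (auto simp: H_def)
      ultimately show ?thesis using card_image[of \<Phi> H] by simp
    qed
    \<comment> \<open>Leaf \<open>True\<close> of path 0 is the vertex \<open>v 0 0\<close>, and
      path 0 exists because \<open>n \<ge> 1\<close>.\<close>
    also have "card {f \<in> cfg n r. leaf True (f 0)} \<le> card (star r G (v 0 0))"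
    proof (rule card_inj_on_le)
      show "inj_on \<Phi> {f \<in> cfg n r. leaf True (f 0)}"
        by (rule inj_on_subset[OF bij_betw_imp_inj_on[OF bij]]) auto
      have "v 0 0 \<in> \<Phi> f" if "leaf True (f 0)" for f
        using that assms(1) unfolding \<Phi>_def by (force simp: leaf_def)
      then show "\<Phi> ` {f \<in> cfg n r. leaf True (f 0)} \<subseteq> star r G (v 0 0)"
        using bij by (auto simp: star_def bij_betw_def)
      show "finite (star r G (v 0 0))" using fin by (simp add: star_def)
    qed
    also have "card (star r G (v 0 0)) \<le> Max ((\<lambda>v. card (star r G v)) ` verts G)"
    proof (rule Max_ge)
      show "finite ((\<lambda>v. card (star r G v)) ` verts G)" unfolding V by simp
      show "card (star r G (v 0 0)) \<in> (\<lambda>v. card (star r G v)) ` verts G"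
        unfolding V using assms(1) by force
    qed
    finally show "card F \<le> Max ((\<lambda>v. card (star r G v)) ` verts G)" .
  qed
qed

end
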